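(* Let $\mathcal{H}_X$ be a real RKHS of functions on $X=\mathbb{R}^d$ uniformly embedded in $\mathcal{C}(X)$, let $\Omega\subseteq X$ be non-empty, and let $t\mapsto x(t)\in X$, $t\ge 0$, be a (continuous) trajectory of the system $\dot x(t)=Ax(t)+Bf(x(t))$, where $A\in\mathbb{R}^{d\times d}$ is Hurwitz, $B\in\mathbb{R}^{d\times 1}$ and $f\in\mathcal{H}_X$. Define $$S_\Omega:=\{h\in\mathcal{H}_X:\|\mathbf{P}_\Omega h\|_{\mathcal{H}_X}=1\}.$$ If the family of composite functions $$\mathbb{U}(S_\Omega):=\{h\circ x: h\in\mathcal{H}_X,\ \|\mathbf{P}_\Omega h\|_{\mathcal{H}_X}=1\}$$ (functions of $t\in[0,\infty)$) is uniformly equicontinuous, then condition PE.2 for the trajectory and the subspace $\mathcal{H}_\Omega$ implies condition PE.1 for the trajectory and the subspace $\mathcal{H}_\Omega$.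
   Context: $\mathcal{H}_X$ has reproducing kernel $\mathfrak{K}:X\times X\to\mathbb{R}$, and $\mathfrak{K}_x:=\mathfrak{K}(\cdot,x)$. The evaluation functional is $\mathcal{E}_x:\mathcal{H}_X\to\mathbb{R}$, $\mathcal{E}_xf=f(x)$, with adjoint $\mathcal{E}_x^*\alpha=\alpha\mathfrak{K}_x$ for $\alpha\in\mathbb{R}$. "Uniformly embedded in $\mathcal{C}(X)$" means that all functions in $\mathcal{H}_X$ are continuous and there is $\bar k<\infty$ with $\sqrt{\mathfrak{K}(x,x)}\le\bar k$ for all $x\in X$. For non-empty $\Omega\subseteq X$, $\mathcal{H}_\Omega:=\overline{\mathrm{span}\{\mathfrak{K}_x:x\in\Omega\}}$ (closure in $\mathcal{H}_X$), and $\mathbf{P}_\Omega:\mathcal{H}_X\to\mathcal{H}_\Omega$ is the orthogonal projection. The composition operator $\mathbb{U}$ associated with the trajectory is $\mathbb{U}h:=h\circ x$. A family of functions is uniformly equicontinuous if for each $\epsilon>0$ there is $\delta>0$ depending only on $\epsilon$ such that any two points of the domain at distance less than $\delta$ are mapped to values differing by less than $\epsilon$ in absolute value, by every function of the family. PE.1: there exist constants $\gamma_1,T_0,\delta,\Delta>0$ such that for each $t\ge T_0$ and any $g\in\mathcal{H}_X$ there exists $s\in[t,t+\Delta]$ with $$\left|\int_s^{s+\delta}\mathcal{E}_{x(\tau)}g\,d\tau\right|\ge\gamma_1\|\mathbf{P}_\Omega g\|_{\mathcal{H}_X}.$$ PE.2: there exist constants $\gamma_2,T_0,\Delta>0$ such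 that for all $t\ge T_0$ and any $g\in\mathcal{H}_X$, $$\int_t^{t+\Delta}\langle\mathcal{E}_{x(\tau)}^*\mathcal{E}_{x(\tau)}g,g\rangle_{\mathcal{H}_X}\,d\tau\ge\gamma_2\|\mathbf{P}_\Omega g\|_{\mathcal{H}_X}^2.$$ *)

theory Defs
  imports "HOL-Analysis.Analysis"
begin

(* A real Hilbert space of functions on 'x is a complete inner product space 'h together with
   an injective linear map ev sending each element to the function it denotes.  The kernel K is
   reproducing: every section K(., x) is (the function of) an element of the space that
   represents evaluation at x. *)
locale rkhs =
  fixes ev :: "'h :: {real_inner, complete_space} \<Rightarrow> 'x \<Rightarrow> real"
    and K :: "'x \<Rightarrow> 'x \<Rightarrow> real"
  assumes ev_add: "ev (g + h) x = ev g x + ev h x"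
    and ev_scaleR: "ev (c *\<^sub>R h) x = c * ev h x"
    and ev_inj: "inj ev"
    and reproducing: "\<exists>k. ev k = (\<lambda>y. K y x) \<and> (\<forall>h. ev h x = h \<bullet> k)"

definition kernel_section :: "('h \<Rightarrow> 'x \<Rightarrow> real) \<Rightarrow> ('x \<Rightarrow> 'x \<Rightarrow> real) \<Rightarrow> 'x \<Rightarrow> 'h" where
  "kernel_section ev K x = (THE k. ev k = (\<lambda>y. K y x))"

definition eval_at :: "('h \<Rightarrow> 'x \<Rightarrow> real) \<Rightarrow> 'x \<Rightarrow> 'h \<Rightarrow> real" where
  "eval_at ev x h = ev h x"

context rkhs
begin

lemma ev_kernel_section: "ev (kernel_section ev K x) = (\<lambda>y. K y x)"
  and ev_eq_inner: "ev h x = h \<bullet> kernel_section ev K x"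
proof -
  obtain k where k: "ev k = (\<lambda>y. K y x)" "\<And>h. ev h x = h \<bullet> k"
    using reproducing[of x] by blast
  have "kernel_section ev K x = k"
    unfolding kernel_section_def using k(1) by (intro the_equality) (auto intro: injD[OF ev_inj])
  with k show "ev (kernel_section ev K x) = (\<lambda>y. K y x)"
    and "ev h x = h \<bullet> kernel_section ev K x" by auto
qed

(* The library's adjoint is defined by choice; for the evaluation functional it is the
   expected map. *)
lemma adjoint_eval_at:
  "adjoint (eval_at ev x) = (\<lambda>\<alpha>. \<alpha> *\<^sub>R kernel_section ev K x)"
  by (rule adjoint_unique) (simp add: eval_at_def ev_eq_inner)

end

definition uniformly_embedded_in_C ::
  "('h \<Rightarrow> 'x :: topological_space \<Rightarrow> real) \<Rightarrow> ('x \<Rightarrow> 'x \<Rightarrow> real) \<Rightarrow> bool" where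
  "uniformly_embedded_in_C ev K \<longleftrightarrow>
     (\<forall>h. continuous_on UNIV (ev h)) \<and> (\<exists>kbar. \<forall>x. sqrt (K x x) \<le> kbar)"

definition H_sub ::
  "('h :: real_inner \<Rightarrow> 'x \<Rightarrow> real) \<Rightarrow> ('x \<Rightarrow> 'x \<Rightarrow> real) \<Rightarrow> 'x set \<Rightarrow> 'h set" where
  "H_sub ev K \<Omega> = closure (span (kernel_section ev K ` \<Omega>))"

(* Well-defined whenever V is a closed subspace of a Hilbert space. *)
definition orth_proj :: "'h :: real_inner set \<Rightarrow> 'h \<Rightarrow> 'h" where
  "orth_proj V g = (THE p. p \<in> V \<and> (\<forall>v\<in>V. orthogonal (g - p) v))"

definition P_sub ::
  "('h :: real_inner \<Rightarrow> 'x \<Rightarrow> real) \<Rightarrow> ('x \<Rightarrow> 'x \<Rightarrow> real) \<Rightarrow> 'x set \<Rightarrow> 'h \<Rightarrow> 'h" where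
  "P_sub ev K \<Omega> = orth_proj (H_sub ev K \<Omega>)"

definition S_sub ::
  "('h :: real_inner \<Rightarrow> 'x \<Rightarrow> real) \<Rightarrow> ('x \<Rightarrow> 'x \<Rightarrow> real) \<Rightarrow> 'x set \<Rightarrow> 'h set" where
  "S_sub ev K \<Omega> = {h. norm (P_sub ev K \<Omega> h) = 1}"

definition composition_op :: "(real \<Rightarrow> 'x) \<Rightarrow> ('x \<Rightarrow> real) \<Rightarrow> real \<Rightarrow> real" where
  "composition_op x \<phi> = \<phi> \<circ> x"

definition uniformly_equicontinuous_on ::
  "'a :: metric_space set \<Rightarrow> ('a \<Rightarrow> real) set \<Rightarrow> bool" where
  "uniformly_equicontinuous_on D F \<longleftrightarrow>
     (\<forall>\<epsilon>>0. \<exists>\<delta>>0. \<forall>\<phi>\<in>F. \<forall>s\<in>D. \<forall>t\<in>D. dist s t < \<delta> \<longrightarrow> \<bar>\<phi> s - \<phi> t\<bar> < \<epsilon>)"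

(* All complex eigenvalues of the real matrix A lie in the open left half-plane. *)
definition hurwitz :: "real ^ 'n ^ 'n \<Rightarrow> bool" where
  "hurwitz A \<longleftrightarrow>
     (\<forall>(l :: complex) (v :: complex ^ 'n).
        v \<noteq> 0 \<and> (\<chi> i j. complex_of_real (A $ i $ j)) *v v = l *s v \<longrightarrow> Re l < 0)"

(* vec turns the scalar f (x t) into a vector of length one.  The derivative is one-sided
   at t = 0. *)
definition is_trajectory ::
  "real ^ 'd ^ 'd \<Rightarrow> real ^ 1 ^ 'd \<Rightarrow> (real ^ 'd \<Rightarrow> real) \<Rightarrow> (real \<Rightarrow> real ^ 'd) \<Rightarrow> bool" where
  "is_trajectory A B f x \<longleftrightarrow>
     (\<forall>t\<ge>0. (x has_vector_derivative (A *v x t + B *v vec (f (x t)))) (at t within {0..}))"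

definition PE1 ::
  "('h :: real_inner \<Rightarrow> 'x \<Rightarrow> real) \<Rightarrow> ('x \<Rightarrow> 'x \<Rightarrow> real) \<Rightarrow> (real \<Rightarrow> 'x) \<Rightarrow> 'x set \<Rightarrow> bool" where
  "PE1 ev K x \<Omega> \<longleftrightarrow>
     (\<exists>\<gamma>\<^sub>1>0. \<exists>T\<^sub>0>0. \<exists>\<delta>>0. \<exists>\<Delta>>0. \<forall>t\<ge>T\<^sub>0. \<forall>g. \<exists>s\<in>{t..t + \<Delta>}.
        \<bar>integral {s..s + \<delta>} (\<lambda>\<tau>. eval_at ev (x \<tau>) g)\<bar> \<ge> \<gamma>\<^sub>1 * norm (P_sub ev K \<Omega> g))"

definition PE2 ::
  "('h :: real_inner \<Rightarrow> 'x \<Rightarrow> real) \<Rightarrow> ('x \<Rightarrow> 'x \<Rightarrow> real) \<Rightarrow> (real \<Rightarrow> 'x) \<Rightarrow> 'x set \<Rightarrow> bool" where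
  "PE2 ev K x \<Omega> \<longleftrightarrow>
     (\<exists>\<gamma>\<^sub>2>0. \<exists>T\<^sub>0>0. \<exists>\<Delta>>0. \<forall>t\<ge>T\<^sub>0. \<forall>g.
        integral {t..t + \<Delta>} (\<lambda>\<tau>. adjoint (eval_at ev (x \<tau>)) (eval_at ev (x \<tau>) g) \<bullet> g)
          \<ge> \<gamma>\<^sub>2 * (norm (P_sub ev K \<Omega> g))\<^sup>2)"

end

theory Submission
  imports Defs
begin

text \<open>
  Condition PE.2 bounds a mean square from below and PE.1 bounds a mean over a short window from
  below.  The passage from the first to the second can fail only if \<open>h \<circ> x\<close> oscillates so fast
  that positive and negative parts cancel on every window; equicontinuity rules this out, with a
  window length that does not depend on \<open>h\<close>.

  Let \<open>h\<close> satisfy \<open>\<parallel>P h\<parallel> = 1\<close>.  By the reproducing property the integrand in PE.2 is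
  \<open>(h (x \<tau>))\<^sup>2\<close>, so on every late interval of length \<open>\<Delta>\<close> its mean is at least \<open>c\<^sup>2 = \<gamma>\<^sub>2 / \<Delta>\<close>, and
  some point \<open>s\<close> of the interval has \<open>\<bar>h (x s)\<bar> \<ge> c\<close> (lemma \<open>ex_abs_ge_of_mean_square\<close>).
  Equicontinuity for \<open>\<epsilon> = c / 2\<close> supplies one window length \<open>\<delta>\<close>, common to all such \<open>h\<close>, on which
  \<open>h \<circ> x\<close> stays within \<open>c / 2\<close> of its value at \<open>s\<close>.  The integral over the window is therefore at
  least \<open>(c / 2) \<delta>\<close> in absolute value (lemma \<open>abs_integral_ge_of_small_oscillation\<close>), which is PE.1
  for \<open>h\<close> with \<open>\<gamma>\<^sub>1 = (c / 2) \<delta>\<close>.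

  Both sides of the inequality in PE.1 are homogeneous in \<open>g\<close>, so a general \<open>g\<close> with \<open>P g \<noteq> 0\<close>
  reduces to \<open>h = g / \<parallel>P g\<parallel>\<close>, and \<open>P g = 0\<close> is trivial.  This reduction needs \<open>P\<close> to be
  homogeneous.  As \<open>P\<close> is given by a definite description, that rests on the existence of
  orthogonal projections onto complete subspaces of an inner product space.
\<close>

section \<open>Orthogonal projection onto a complete subspace\<close>

text \<open>
  Existence of the nearest point: by the parallelogram identity
  \<open>\<parallel>v - w\<parallel>\<^sup>2 = 2 \<parallel>g - v\<parallel>\<^sup>2 + 2 \<parallel>g - w\<parallel>\<^sup>2 - 4 \<parallel>g - (v + w) / 2\<parallel>\<^sup>2\<close>, two members of \<open>V\<close> whose squared
  distances to \<open>g\<close> are nearly minimal are close to each other, because their midpoint, which is in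
  \<open>V\<close> again, cannot do better than the infimum.  So a minimizing sequence is Cauchy.
\<close>
lemma ex_nearest_point_complete_convex:
  fixes V :: "'a :: real_inner set"
  assumes "convex V" "complete V" "V \<noteq> {}"
  obtains p where "p \<in> V" "\<And>v. v \<in> V \<Longrightarrow> norm (g - p) \<le> norm (g - v)"
proof -
  define D where "D = (INF v\<in>V. (norm (g - v))\<^sup>2)"
  have bdd: "bdd_below ((\<lambda>v. (norm (g - v))\<^sup>2) ` V)"
    by (rule bdd_belowI2[of _ 0]) simp
  have D_le: "D \<le> (norm (g - v))\<^sup>2" if "v \<in> V" for v
    unfolding D_def by (rule cINF_lower[OF bdd that])
  have "\<exists>v\<in>V. (norm (g - v))\<^sup>2 < D + inverse (real (Suc n))" for n
  proof -
    have "D < D + inverse (real (Suc n))" by simp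
    then show ?thesis
      unfolding D_def using cINF_less_iff[OF \<open>V \<noteq> {}\<close> bdd] by blast
  qed
  then obtain u where u: "\<And>n. u n \<in> V"
    and u_less: "\<And>n. (norm (g - u n))\<^sup>2 < D + inverse (real (Suc n))"
    by metis
  have close: "(norm (u m - u n))\<^sup>2 \<le> 2 * inverse (real (Suc m)) + 2 * inverse (real (Suc n))" for m n
  proof -
    have "(1/2) *\<^sub>R u m + (1/2) *\<^sub>R u n \<in> V"
      using \<open>convex V\<close> u by (auto intro: convexD)
    then have "D \<le> (norm (g - ((1/2) *\<^sub>R u m + (1/2) *\<^sub>R u n)))\<^sup>2"
      by (rule D_le)
    moreover have "(norm (u m - u n))\<^sup>2 = 2 * (norm (g - u m))\<^sup>2 + 2 * (norm (g - u n))\<^sup>2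
        - 4 * (norm (g - ((1/2) *\<^sub>R u m + (1/2) *\<^sub>R u n)))\<^sup>2"
      by (simp add: power2_norm_eq_inner inner_simps inner_commute field_simps)
    ultimately show ?thesis
      using u_less[of m] u_less[of n] by linarith
  qed
  have "Cauchy u"
  proof (rule metric_CauchyI)
    fix e :: real assume "0 < e"
    then obtain N where N: "inverse (real (Suc N)) < e\<^sup>2 / 4"
      using reals_Archimedean[of "e\<^sup>2 / 4"] by auto
    have "dist (u m) (u n) < e" if "m \<ge> N" "n \<ge> N" for m n
    proof -
      have "inverse (real (Suc m)) \<le> inverse (real (Suc N))"
           "inverse (real (Suc n)) \<le> inverse (real (Suc N))"
        using that by (auto intro!: le_imp_inverse_le)
      then have "(norm (u m - u n))\<^sup>2 < e\<^sup>2"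
        using close[of m n] N by linarith
      then show ?thesis
        using \<open>0 < e\<close> by (auto simp: dist_norm intro: power_less_imp_less_base)
    qed
    then show "\<exists>N. \<forall>m\<ge>N. \<forall>n\<ge>N. dist (u m) (u n) < e" by blast
  qed
  then obtain p where "p \<in> V" and lim: "u \<longlonglongrightarrow> p"
    using \<open>complete V\<close> u unfolding complete_def by blast
  have "(\<lambda>n. (norm (g - u n))\<^sup>2) \<longlonglongrightarrow> (norm (g - p))\<^sup>2"
    by (intro tendsto_intros lim)
  moreover have "(\<lambda>n. D + inverse (real (Suc n))) \<longlonglongrightarrow> D + 0"
    by (intro tendsto_intros LIMSEQ_inverse_real_of_nat)
  ultimately have "(norm (g - p))\<^sup>2 \<le> D + 0"
    by (rule LIMSEQ_le) (intro exI allI impI less_imp_le u_less)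
  then have "norm (g - p) \<le> norm (g - v)" if "v \<in> V" for v
    using D_le[OF that] by (intro power2_le_imp_le[OF _ norm_ge_zero]) linarith
  with \<open>p \<in> V\<close> that show thesis by blast
qed

text \<open>
  In a subspace the variational inequality at the nearest point \<open>p\<close> holds in both directions \<open>v\<close>
  and \<open>-v\<close>, which turns it into orthogonality.
\<close>
lemma ex_orthogonal_projection:
  fixes V :: "'a :: real_inner set"
  assumes "subspace V" "complete V"
  obtains p where "p \<in> V" "\<And>v. v \<in> V \<Longrightarrow> orthogonal (g - p) v"
proof -
  have "convex V" "V \<noteq> {}"
    using \<open>subspace V\<close> subspace_0 by (auto intro: subspace_imp_convex)
  then obtain p where p: "p \<in> V" "\<And>v. v \<in> V \<Longrightarrow> norm (g - p) \<le> norm (g - v)"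
    using ex_nearest_point_complete_convex[OF _ \<open>complete V\<close>] by metis
  have le: "(g - p) \<bullet> v \<le> 0" if "v \<in> V" for v
    using any_closest_point_dot[OF \<open>convex V\<close> complete_imp_closed[OF \<open>complete V\<close>] p(1), of "p + v" g]
      that p by (simp add: dist_norm subspace_add[OF \<open>subspace V\<close>])
  have "orthogonal (g - p) v" if "v \<in> V" for v
    using le[OF that] le[of "- v"] that subspace_neg[OF \<open>subspace V\<close>] by (simp add: orthogonal_def)
  with p(1) that show thesis by blast
qed

lemma orth_proj_eqI:
  assumes "subspace V" "p \<in> V" "\<And>v. v \<in> V \<Longrightarrow> orthogonal (g - p) v"
  shows "orth_proj V g = p"
  unfolding orth_proj_def
proof (rule the_equality)
  fix q assume q: "q \<in> V \<and> (\<forall>v\<in>V. orthogonal (g - q) v)"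
  then have "p - q \<in> V"
    using assms by (simp add: subspace_diff)
  then have "(g - q) \<bullet> (p - q) = 0" "(g - p) \<bullet> (p - q) = 0"
    using q assms(3) by (auto simp: orthogonal_def)
  then have "(p - q) \<bullet> (p - q) = 0"
    by (simp add: inner_diff_left)
  then show "q = p" by simp
qed (use assms in auto)

lemma orth_proj_scaleR:
  assumes "subspace V" "complete V"
  shows "orth_proj V (c *\<^sub>R g) = c *\<^sub>R orth_proj V g"
proof -
  obtain p where p: "p \<in> V" "\<And>v. v \<in> V \<Longrightarrow> orthogonal (g - p) v"
    using ex_orthogonal_projection[OF assms] by metis
  have "orth_proj V (c *\<^sub>R g) = c *\<^sub>R p"
    by (rule orth_proj_eqI[OF assms(1)])
      (use p assms(1) in \<open>auto simp: subspace_scale orthogonal_def simp flip: scaleR_diff_right\<close>)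
  also have "p = orth_proj V g"
    using orth_proj_eqI[OF assms(1) p] by simp
  finally show ?thesis .
qed

lemma subspace_closure:
  fixes S :: "'a :: real_normed_vector set"
  assumes "subspace S"
  shows "subspace (closure S)"
proof (rule subspaceI)
  show "0 \<in> closure S"
    using subspace_0[OF assms] closure_subset by blast
  show "a + b \<in> closure S" if a: "a \<in> closure S" and b: "b \<in> closure S" for a b
  proof -
    obtain u where u: "\<And>n. u n \<in> S" "u \<longlonglongrightarrow> a"
      using a unfolding closure_sequential by metis
    obtain w where w: "\<And>n. w n \<in> S" "w \<longlonglongrightarrow> b"
      using b unfolding closure_sequential by metis
    have "u n + w n \<in> S" for n
      by (intro subspace_add assms u w)
    moreover have "(\<lambda>n. u n + w n) \<longlonglongrightarrow> a + b"
      by (intro tendsto_add u w)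
    ultimately show ?thesis
      unfolding closure_sequential by (intro exI[of _ "\<lambda>n. u n + w n"]) simp
  qed
  show "c *\<^sub>R a \<in> closure S" if a: "a \<in> closure S" for a c
  proof -
    obtain u where u: "\<And>n. u n \<in> S" "u \<longlonglongrightarrow> a"
      using a unfolding closure_sequential by metis
    have "c *\<^sub>R u n \<in> S" for n
      by (intro subspace_scale assms u)
    moreover have "(\<lambda>n. c *\<^sub>R u n) \<longlonglongrightarrow> c *\<^sub>R a"
      by (intro tendsto_scaleR tendsto_const u)
    ultimately show ?thesis
      unfolding closure_sequential by (intro exI[of _ "\<lambda>n. c *\<^sub>R u n"]) simp
  qed
qed

lemma P_sub_scaleR:
  fixes ev :: "'h :: {real_inner, complete_space} \<Rightarrow> 'x \<Rightarrow> real"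
  shows "P_sub ev K \<Omega> (c *\<^sub>R g) = c *\<^sub>R P_sub ev K \<Omega> g"
  unfolding P_sub_def H_sub_def
  by (intro orth_proj_scaleR subspace_closure subspace_span) (simp only: complete_eq_closed closed_closure)

section \<open>From a mean square to a mean over a window\<close>

lemma ex_abs_ge_of_mean_square:
  fixes \<phi> :: "real \<Rightarrow> real"
  assumes "a < b" "continuous_on {a..b} \<phi>" "c\<^sup>2 * (b - a) \<le> integral {a..b} (\<lambda>\<tau>. (\<phi> \<tau>)\<^sup>2)"
  obtains s where "s \<in> {a..b}" "c \<le> \<bar>\<phi> s\<bar>"
proof -
  have cont: "continuous_on {a..b} (\<lambda>\<tau>. (\<phi> \<tau>)\<^sup>2)"
    by (intro continuous_intros assms)
  obtain s where s: "s \<in> {a..b}" "\<And>\<tau>. \<tau> \<in> {a..b} \<Longrightarrow> (\<phi> \<tau>)\<^sup>2 \<le> (\<phi> s)\<^sup>2"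
    using continuous_attains_sup[OF _ _ cont] \<open>a < b\<close> by auto
  have "norm (integral {a..b} (\<lambda>\<tau>. (\<phi> \<tau>)\<^sup>2)) \<le> (\<phi> s)\<^sup>2 * (b - a)"
    by (rule integral_bound) (use assms(1) cont s in auto)
  with assms(3) have "c\<^sup>2 * (b - a) \<le> (\<phi> s)\<^sup>2 * (b - a)"
    by simp
  with \<open>a < b\<close> have "c\<^sup>2 \<le> \<bar>\<phi> s\<bar>\<^sup>2"
    by simp
  then have "c \<le> \<bar>\<phi> s\<bar>"
    by (rule power2_le_imp_le) simp
  with s(1) that show thesis by blast
qed

text \<open>
  Comparing \<open>\<phi>\<close> with the constant \<open>\<phi> s\<close> treats both signs of \<open>\<phi> s\<close> at once: replacing \<open>\<phi>\<close> by that
  constant changes the integral by at most \<open>\<eta> \<delta>\<close>.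
\<close>
lemma abs_integral_ge_of_small_oscillation:
  fixes \<phi> :: "real \<Rightarrow> real"
  assumes "0 \<le> \<delta>" "continuous_on {s..s + \<delta>} \<phi>" "c \<le> \<bar>\<phi> s\<bar>"
    and "\<And>\<tau>. \<tau> \<in> {s..s + \<delta>} \<Longrightarrow> \<bar>\<phi> \<tau> - \<phi> s\<bar> \<le> \<eta>"
  shows "(c - \<eta>) * \<delta> \<le> \<bar>integral {s..s + \<delta>} \<phi>\<bar>"
proof -
  have "norm (integral {s..s + \<delta>} (\<lambda>\<tau>. \<phi> \<tau> - \<phi> s)) \<le> \<eta> * (s + \<delta> - s)"
    by (rule integral_bound) (use assms in \<open>auto intro!: continuous_intros\<close>)
  moreover have "integral {s..s + \<delta>} (\<lambda>\<tau>. \<phi> \<tau> - \<phi> s) = integral {s..s + \<delta>} \<phi> - \<delta> * \<phi> s"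
    using assms(1,2) by (subst integral_diff) (auto intro: integrable_continuous_interval)
  ultimately have "\<bar>integral {s..s + \<delta>} \<phi> - \<delta> * \<phi> s\<bar> \<le> \<eta> * \<delta>"
    by simp
  moreover have "c * \<delta> \<le> \<bar>\<delta> * \<phi> s\<bar>"
    using mult_right_mono[OF assms(3,1)] assms(1) by (simp add: abs_mult mult.commute)
  ultimately show ?thesis
    by (simp add: left_diff_distrib)
qed

section \<open>The two excitation conditions\<close>

lemma (in rkhs) inner_adjoint_eval_at:
  "adjoint (eval_at ev y) (eval_at ev y g) \<bullet> g = (ev g y)\<^sup>2"
  by (simp add: adjoint_eval_at eval_at_def ev_eq_inner[of g] inner_commute[of _ g] power2_eq_square)

lemma is_trajectory_continuous_on:
  assumes "is_trajectory A B \<phi> x"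
  shows "continuous_on {0..} x"
  unfolding continuous_on_eq_continuous_within
  using assms by (auto simp: is_trajectory_def intro: has_vector_derivative_continuous)

text \<open>
  The level \<open>c\<close> comes from the constants of PE.2 and the window length \<open>\<delta>\<close> from the common modulus
  of the family, so both are fixed before \<open>t\<close> and \<open>g\<close>, as the order of quantifiers in PE.1 demands;
  only the start \<open>s\<close> of the window depends on \<open>t\<close> and \<open>g\<close>.
\<close>
lemma (in rkhs) PE2_imp_PE1:
  fixes x :: "real \<Rightarrow> 'x"
  assumes cont: "\<And>h. continuous_on {0..} (\<lambda>\<tau>. ev h (x \<tau>))"
    and equi: "uniformly_equicontinuous_on {0..} (composition_op x ` ev ` S_sub ev K \<Omega>)"
    and "PE2 ev K x \<Omega>"
  shows "PE1 ev K x \<Omega>"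
proof -
  obtain \<gamma> T \<Delta> where pos: "\<gamma> > 0" "T > 0" "\<Delta> > 0"
    and PE2: "\<And>t g. t \<ge> T \<Longrightarrow>
      \<gamma> * (norm (P_sub ev K \<Omega> g))\<^sup>2 \<le> integral {t..t + \<Delta>} (\<lambda>\<tau>. (ev g (x \<tau>))\<^sup>2)"
    using \<open>PE2 ev K x \<Omega>\<close> unfolding PE2_def inner_adjoint_eval_at by blast
  define c where "c = sqrt (\<gamma> / \<Delta>)"
  have "c > 0" and c2: "c\<^sup>2 * \<Delta> = \<gamma>"
    using pos by (simp_all add: c_def)
  obtain d where "d > 0" and d: "\<And>h s \<tau>. \<lbrakk>norm (P_sub ev K \<Omega> h) = 1; 0 \<le> s; 0 \<le> \<tau>; dist \<tau> s < d\<rbrakk>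
      \<Longrightarrow> \<bar>ev h (x \<tau>) - ev h (x s)\<bar> < c / 2"
    using equi[unfolded uniformly_equicontinuous_on_def, rule_format, of "c / 2"] \<open>c > 0\<close>
    by (auto simp: composition_op_def S_sub_def)
  \<comment> \<open>The modulus \<open>d\<close> controls distances strictly below \<open>d\<close>; halving it covers a closed window.\<close>
  define \<delta> where "\<delta> = d / 2"
  have "\<delta> > 0" "\<delta> < d"
    using \<open>d > 0\<close> by (simp_all add: \<delta>_def)
  have unit: "\<exists>s\<in>{t..t + \<Delta>}. c / 2 * \<delta> \<le> \<bar>integral {s..s + \<delta>} (\<lambda>\<tau>. ev h (x \<tau>))\<bar>"
    if "t \<ge> T" and h: "norm (P_sub ev K \<Omega> h) = 1" for t h
  proof -
    have cont_h: "continuous_on {a..b} (\<lambda>\<tau>. ev h (x \<tau>))" if "0 \<le> a" for a b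
      by (rule continuous_on_subset[OF cont]) (use that in auto)
    have "0 \<le> t"
      using \<open>t \<ge> T\<close> \<open>T > 0\<close> by simp
    obtain s where s: "s \<in> {t..t + \<Delta>}" "c \<le> \<bar>ev h (x s)\<bar>"
      using ex_abs_ge_of_mean_square[OF _ cont_h, of t "t + \<Delta>" c] PE2[OF \<open>t \<ge> T\<close>, of h]
        \<open>\<Delta> > 0\<close> \<open>0 \<le> t\<close> h c2 by auto
    have "(c - c / 2) * \<delta> \<le> \<bar>integral {s..s + \<delta>} (\<lambda>\<tau>. ev h (x \<tau>))\<bar>"
    proof (rule abs_integral_ge_of_small_oscillation)
      show "\<bar>ev h (x \<tau>) - ev h (x s)\<bar> \<le> c / 2" if "\<tau> \<in> {s..s + \<delta>}" for \<tau>
        using d[OF h, of s \<tau>] that s(1) \<open>0 \<le> t\<close> \<open>\<delta> < d\<close> by (simp add: dist_real_def)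
    qed (use s \<open>\<delta> > 0\<close> \<open>0 \<le> t\<close> cont_h in auto)
    with s(1) show ?thesis by auto
  qed
  have main: "\<exists>s\<in>{t..t + \<Delta>}. c / 2 * \<delta> * norm (P_sub ev K \<Omega> g) \<le> \<bar>integral {s..s + \<delta>} (\<lambda>\<tau>. ev g (x \<tau>))\<bar>"
    if "t \<ge> T" for t g
  proof (cases "P_sub ev K \<Omega> g = 0")
    case True
    then show ?thesis
      using \<open>\<Delta> > 0\<close> by (intro bexI[of _ t]) auto
  next
    case False
    define N where "N = norm (P_sub ev K \<Omega> g)"
    have "N > 0"
      using False by (simp add: N_def)
    have "norm (P_sub ev K \<Omega> (inverse N *\<^sub>R g)) = 1"
      using \<open>N > 0\<close> by (simp add: P_sub_scaleR N_def)
    then obtain s where s: "s \<in> {t..t + \<Delta>}"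
      and "c / 2 * \<delta> \<le> \<bar>integral {s..s + \<delta>} (\<lambda>\<tau>. ev (inverse N *\<^sub>R g) (x \<tau>))\<bar>"
      using unit[OF \<open>t \<ge> T\<close>] by blast
    then have "c / 2 * \<delta> \<le> inverse N * \<bar>integral {s..s + \<delta>} (\<lambda>\<tau>. ev g (x \<tau>))\<bar>"
      using \<open>N > 0\<close> by (simp add: ev_scaleR abs_mult)
    then have "c / 2 * \<delta> * N \<le> \<bar>integral {s..s + \<delta>} (\<lambda>\<tau>. ev g (x \<tau>))\<bar>"
      using \<open>N > 0\<close> by (simp add: field_simps)
    with s show ?thesis
      unfolding N_def by blast
  qed
  have "c / 2 * \<delta> > 0"
    using \<open>c > 0\<close> \<open>\<delta> > 0\<close> by simp
  with main pos \<open>\<delta> > 0\<close> show ?thesis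
    unfolding PE1_def eval_at_def by blast
qed

theorem theorem5:
  fixes ev :: "'h :: {real_inner, complete_space} \<Rightarrow> real ^ 'd \<Rightarrow> real"
    and K :: "real ^ 'd \<Rightarrow> real ^ 'd \<Rightarrow> real"
    and \<Omega> :: "(real ^ 'd) set"
    and A :: "real ^ 'd ^ 'd"
    and B :: "real ^ 1 ^ 'd"
    and f :: 'h
    and x :: "real \<Rightarrow> real ^ 'd"
  assumes "rkhs ev K"
    and "uniformly_embedded_in_C ev K"
    and "\<Omega> \<noteq> {}"
    and "hurwitz A"
    and "is_trajectory A B (ev f) x"
    and "uniformly_equicontinuous_on {0..} (composition_op x ` ev ` S_sub ev K \<Omega>)"
    and "PE2 ev K x \<Omega>"
  shows "PE1 ev K x \<Omega>"
proof (rule rkhs.PE2_imp_PE1[OF \<open>rkhs ev K\<close> _ assms(6,7)])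
  fix h
  have "continuous_on UNIV (ev h)"
    using assms(2) by (simp add: uniformly_embedded_in_C_def)
  then show "continuous_on {0..} (\<lambda>\<tau>. ev h (x \<tau>))"
    by (rule continuous_on_compose2[OF _ is_trajectory_continuous_on[OF assms(5)]]) simp
qed

end
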